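(* Let $w=x_j^tx_k^m$, where $t\neq 0$ and $m\neq 0$ are integers and $j\neq k$ are integers mod $n$. Assume that, mod $n$, $j\ne 1$, $k\ne 2$, $2j-1\ne k$, $j\ne k-1$, $j\ne 2k-2$, and $j+k\ne 3$. Then the standard 2-complex $K(C(n,w))$ of the cyclic presentation $$C(n,w)=\langle x_1,\ldots,x_n \mid x_1w=wx_2,\ x_2\phi(w)=\phi(w)x_3,\ \ldots,\ x_n\phi^{n-1}(w)=\phi^{n-1}(w)x_1\rangle$$ is diagrammatically reducible (DR).
   Context: $F$ is the free group on generators $x_1,\ldots,x_n$, with subscripts read mod $n$, and $\phi$ is the shift automorphism of $F$ defined by $\phi(x_i)=x_{i+1}$ for $1\le i\le n-1$ and $\phi(x_n)=x_1$. For a presentation $P$, $K(P)$ denotes the associated standard 2-complex (one vertex, one edge per generator, one 2-cell per relator attached along the relator); here the relation $x_i\phi^{i-1}(w)=\phi^{i-1}(w)x_{i+1}$ corresponds to the relator $x_i\phi^{i-1}(w)x_{i+1}^{-1}\phi^{i-1}(w)^{-1}$. The standard 2-complex $K$ of a finite presentation is called diagrammatically reducible (DR) if there is no reduced spherical diagram $f\colon C\to K$. Here a spherical diagram is a combinatorial map $f\colon C\to K$ (mapping open cells homeomorphically onto open cells) where $C$ is a cell decomposition of the 2-sphere. It is reduced if there is no pair of distinct 2-cells of $C$ sharing an edge $e$ that are mapped by $f$ to the same 2-cell of $K$ as mirror images of each other across $e$ (i.e. by folding over $e$). *)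

theory Defs
  imports "HOL-Combinatorics.Combinatorics" "HOL-Number_Theory.Cong"
begin

section \<open>Words and presentations\<close>

text \<open>A letter is a generator together with a sign; \<open>True\<close> stands for exponent \<open>1\<close> and
  \<open>False\<close> for exponent \<open>-1\<close>. Words are not assumed to be reduced: the 2-cells of the standard
  complex are attached along the relators as written.\<close>

type_synonym 'g letter = "'g \<times> bool"
type_synonym 'g word = "'g letter list"

definition inv_letter :: "'g letter \<Rightarrow> 'g letter" where
  "inv_letter a = (fst a, \<not> snd a)"

definition inv_word :: "'g word \<Rightarrow> 'g word" where
  "inv_word u = rev (map inv_letter u)"

definition gen_power :: "'g \<Rightarrow> int \<Rightarrow> 'g word" where
  "gen_power x e = replicate (nat \<bar>e\<bar>) (x, 0 < e)"

text \<open>The relators form an indexed family, because two relators that happen to be equal as words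
  still give two different 2-cells. A presentation is at the same time the combinatorial
  description of its standard 2-complex: one vertex, one edge for each generator, and one 2-cell
  for each relator index, attached along the relator.\<close>

record ('g, 'i) presentation =
  generators :: "'g set"
  relator_index :: "'i set"
  relator :: "'i \<Rightarrow> 'g word"

section \<open>Cell decompositions of the 2-sphere\<close>

text \<open>A cell decomposition of the 2-sphere (necessarily finite) with at least one edge is given by
  its set \<open>D\<close> of oriented edges, the map \<open>opp\<close> reversing the orientation of an edge, and the map
  \<open>nxt\<close> sending an oriented edge to its successor on the boundary of the 2-cell on its left.
  The edges are the orbits of \<open>opp\<close> and the 2-cells are the orbits of \<open>nxt\<close>. The oriented edges
  \<open>d\<close> and \<open>nxt (opp d)\<close> leave the same vertex and are neighbours in the rotation about it, so the
  vertices are the orbits of \<open>nxt \<circ> opp\<close>. Gluing polygons along these data gives a closed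
  oriented surface, which is a sphere iff it is connected of Euler characteristic 2.\<close>

locale sphere_decomposition =
  fixes D :: "'d set" and opp nxt :: "'d \<Rightarrow> 'd"
  assumes finite_D: "finite D"
    and opp_permutes: "opp permutes D"
    and opp_opp: "d \<in> D \<Longrightarrow> opp (opp d) = d"
    and opp_neq: "d \<in> D \<Longrightarrow> opp d \<noteq> d"
    and nxt_permutes: "nxt permutes D"
    and connected_D:
      "d \<in> D \<Longrightarrow> d' \<in> D \<Longrightarrow> (d, d') \<in> {(a, b). a \<in> D \<and> (b = opp a \<or> b = nxt a)}\<^sup>*"
    and euler_characteristic:
      "int (card (orbit (nxt \<circ> opp) ` D)) - int (card (orbit opp ` D))
         + int (card (orbit nxt ` D)) = 2"

section \<open>Spherical diagrams and diagrammatic reducibility\<close>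

text \<open>A combinatorial map from a cell decomposition to the standard 2-complex of \<open>P\<close>.
  The oriented edge \<open>d\<close> is mapped to the letter \<open>lab d\<close>. The 2-cell on the left of \<open>d\<close> is mapped
  homeomorphically to the 2-cell with index \<open>cell d\<close>, preserving the orientation iff \<open>pos_or d\<close>,
  and \<open>d\<close> itself goes to the edge at position \<open>pos d\<close> of the attaching word. Recording the
  position is needed if the relator is a proper power, as the labels then do not determine the map
  on the 2-cell. The condition on the number of edges of a 2-cell excludes branched
  coverings.\<close>

locale spherical_diagram = sphere_decomposition D opp nxt
  for P :: "('g, 'i) presentation"
    and D :: "'d set" and opp nxt :: "'d \<Rightarrow> 'd" +
  fixes lab :: "'d \<Rightarrow> 'g letter"
    and cell :: "'d \<Rightarrow> 'i" and pos :: "'d \<Rightarrow> nat" and pos_or :: "'d \<Rightarrow> bool"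
  assumes lab_generator: "d \<in> D \<Longrightarrow> fst (lab d) \<in> generators P"
    and lab_opp: "d \<in> D \<Longrightarrow> lab (opp d) = inv_letter (lab d)"
    and cell_index: "d \<in> D \<Longrightarrow> cell d \<in> relator_index P"
    and pos_less: "d \<in> D \<Longrightarrow> pos d < length (relator P (cell d))"
    and lab_pos: "d \<in> D \<Longrightarrow> lab d =
      (if pos_or d then relator P (cell d) ! pos d else inv_letter (relator P (cell d) ! pos d))"
    and cell_nxt: "d \<in> D \<Longrightarrow> cell (nxt d) = cell d"
    and pos_or_nxt: "d \<in> D \<Longrightarrow> pos_or (nxt d) = pos_or d"
    and pos_nxt: "d \<in> D \<Longrightarrow> pos (nxt d) =
      (let l = length (relator P (cell d))
       in if pos_or d then (pos d + 1) mod l else (pos d + l - 1) mod l)"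
    and cell_size: "d \<in> D \<Longrightarrow> card (orbit nxt d) = length (relator P (cell d))"

text \<open>The two 2-cells at the edge \<open>{d, opp d}\<close> are mirror images of each other across this edge if
  they have the same image, with opposite orientations, and the edge has the same position in the
  attaching word as seen from both of them.\<close>

definition (in spherical_diagram) folds_over :: "'d \<Rightarrow> bool" where
  "folds_over d \<longleftrightarrow> orbit nxt d \<noteq> orbit nxt (opp d) \<and> cell (opp d) = cell d
     \<and> pos (opp d) = pos d \<and> pos_or (opp d) \<noteq> pos_or d"

definition (in spherical_diagram) reduced :: bool where
  "reduced \<longleftrightarrow> (\<forall>d\<in>D. \<not> folds_over d)"

text \<open>Since \<open>D\<close> is finite, it is no restriction to take its elements to be natural numbers. The
  first conjunct accounts for the only cell decomposition without edges (one vertex and one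
  2-cell): it admits a combinatorial map to the standard 2-complex iff some relator is the
  empty word, and the resulting spherical diagram is reduced.\<close>

definition diagrammatically_reducible :: "('g, 'i) presentation \<Rightarrow> bool" where
  "diagrammatically_reducible P \<longleftrightarrow>
     (\<forall>i\<in>relator_index P. relator P i \<noteq> []) \<and>
     \<not> (\<exists>(D :: nat set) opp nxt lab cell pos pos_or.
          spherical_diagram P D opp nxt lab cell pos pos_or \<and>
          spherical_diagram.reduced D opp nxt cell pos pos_or)"

section \<open>The cyclic presentations\<close>

text \<open>Subscripts are read mod \<open>n\<close>: the generators are the residues \<open>0, \<dots>, n - 1\<close>, and
  \<open>x\<^sub>n\<close> is the residue \<open>0\<close>.\<close>

definition gen :: "nat \<Rightarrow> int \<Rightarrow> int" where
  "gen n i = i mod int n"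

definition shift :: "nat \<Rightarrow> int word \<Rightarrow> int word" where
  "shift n = map (\<lambda>(i, s). (gen n (i + 1), s))"

definition cyclic_presentation :: "nat \<Rightarrow> int word \<Rightarrow> (int, nat) presentation" where
  "cyclic_presentation n w =
     \<lparr>generators = gen n ` {1..int n},
      relator_index = {1..n},
      relator = (\<lambda>i. let v = (shift n ^^ (i - 1)) w in
        [(gen n (int i), True)] @ v @ [(gen n (int i + 1), False)] @ inv_word v)\<rparr>"

end

theory Submission
  imports Defs
begin

text \<open>The proof is a combinatorial curvature argument. Write \<open>a = i + j - 1\<close> and \<open>b = i + k - 1\<close>, so that the
  \<open>i\<close>-th relator is \<open>x\<^sub>i u x\<^sub>i\<^sub>+\<^sub>1\<^sup>-\<^sup>1 u\<^sup>-\<^sup>1\<close> with \<open>u = x\<^sub>a\<^sup>t x\<^sub>b\<^sup>m\<close>. It has six corners at which the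
  syllable changes. Give these the angle \<open>2/3\<close> and the corners inside a power the angle \<open>1\<close>, in
  units of \<open>\<pi>\<close>. The angles of a 2-cell with \<open>l\<close> edges then sum to \<open>l - 2\<close>, so by Euler's formula some
  vertex of a spherical diagram has angle sum less than \<open>2\<close>. Such a vertex has degree \<open>2\<close>, and this
  happens in two ways: two copies of \<open>u\<close> are glued along their middle corner, or one of \<open>2(j - 1)\<close>,
  \<open>2(k - 2)\<close>, \<open>2(k - j)\<close> vanishes modulo \<open>n\<close>. The angles are therefore corrected by a flow of \<open>1/3\<close>
  along certain edges, from one end to the other, which leaves the total unchanged. After the
  correction every vertex of a reduced diagram has angle sum at least \<open>2\<close>, a contradiction.\<close>

section \<open>Angles at a vertex\<close>

text \<open>The syllable of a relator to which an edge belongs, as seen from one of its two 2-cells: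
  \<open>Hor True\<close> is \<open>x\<^sub>i\<close>, \<open>Hor False\<close> is \<open>x\<^sub>i\<^sub>+\<^sub>1\<close>, \<open>Run True\<close> is either copy of \<open>x\<^sub>a\<^sup>t\<close>, and
  \<open>Run False\<close> is either copy of \<open>x\<^sub>b\<^sup>m\<close>.\<close>

datatype side = Hor bool | Run bool

lemma side_cases:
  obtains "r = Hor True" | "r = Hor False" | "r = Run True" | "r = Run False"
  by (metis side.exhaust)

text \<open>The triple \<open>(a, b, k)\<close> stands for \<open>a A + b B + k c\<close>, the change of the subscript across a
  corner. Keeping the coefficients lets the simplifier decide the case distinctions below.\<close>

fun add3 :: "int \<times> int \<times> int \<Rightarrow> int \<times> int \<times> int \<Rightarrow> int \<times> int \<times> int" where
  "add3 (a, b, k) (a', b', k') = (a + a', b + b', k + k')"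

fun turn :: "side \<Rightarrow> side \<Rightarrow> int \<times> int \<times> int" where
  "turn (Hor p) (Hor q) = (0, 0, 0)"
| "turn (Hor p) (Run q) = (if q then (1, 0, 0) else (0, 1, 0))"
| "turn (Run p) (Hor q) = (if p then (-1, 0, 0) else (0, -1, 0))"
| "turn (Run p) (Run q) = (if p = q then (0, 0, 0) else if p then (0, 0, 1) else (0, 0, -1))"

text \<open>Angles are multiplied by \<open>3\<close>.\<close>

definition corner_weight :: "side \<Rightarrow> side \<Rightarrow> int" where
  "corner_weight r r' = (if r = r' then 3 else 2)"

text \<open>The parameters are \<open>A = a - i\<close>, \<open>B = b - (i + 1)\<close> and \<open>c = b - a\<close>, and \<open>\<sigma> p\<close> is the sign of a letter
  of \<open>Run p\<close> that is read from the outer end of the run, the one adjacent to \<open>Hor p\<close>. Reversing the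
  relator exchanges \<open>True\<close> and \<open>False\<close>.\<close>

locale link_parameters =
  fixes n A B c :: int and \<sigma> :: "bool \<Rightarrow> bool"
  assumes c_eq: "c = B - A + 1"
    and not_dvd_A: "\<not> n dvd A" and not_dvd_B: "\<not> n dvd B" and not_dvd_c: "\<not> n dvd c"
    and not_dvd_diff: "\<not> n dvd A - B" and not_dvd_sum: "\<not> n dvd A + B"
    and not_dvd_A_c: "\<not> n dvd A - c" and not_dvd_B_c: "\<not> n dvd B + c"
begin

fun shift_of :: "int \<times> int \<times> int \<Rightarrow> int" where
  "shift_of (a, b, k) = a * A + b * B + k * c"

definition closed :: "int \<times> int \<times> int \<Rightarrow> bool" where
  "closed v \<longleftrightarrow> n dvd shift_of v"

fun signs_match :: "side \<Rightarrow> bool \<Rightarrow> side \<Rightarrow> bool \<Rightarrow> bool" where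
  "signs_match (Hor p) s (Hor q) t \<longleftrightarrow> False"
| "signs_match (Hor p) s (Run q) t \<longleftrightarrow> p = q \<and> t = \<sigma> q"
| "signs_match (Run p) s (Hor q) t \<longleftrightarrow> p = q \<and> s = \<sigma> p"
| "signs_match (Run p) s (Run q) t \<longleftrightarrow> (if p = q then s \<noteq> t else s \<noteq> \<sigma> p \<and> t \<noteq> \<sigma> q)"

text \<open>The edges of the link (star graph) of the vertex of the complex; a letter stands for the end at which
  an edge with that label leaves the vertex.\<close>

definition corner :: "side \<Rightarrow> int letter \<Rightarrow> side \<Rightarrow> int letter \<Rightarrow> bool" where
  "corner r x r' y \<longleftrightarrow>
     signs_match r (snd x) r' (snd y) \<and> n dvd fst y - fst x - shift_of (turn r r')"

text \<open>What the start of an edge gains if its label has sign \<open>s\<close> and its two 2-cells see it in the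
  syllables \<open>l\<close> and \<open>r\<close>. Between two runs the flow goes from the outer to the inner end, which makes up
  for two copies of \<open>u\<close> glued along their middle corner; \<open>run_swap\<close> is the case in which the two copies
  can be glued with \<open>x\<^sub>a\<close> and \<open>x\<^sub>b\<close> exchanged. Between \<open>Hor p\<close> and \<open>Run p\<close> it goes from the inner to the
  outer end, and is needed only if \<open>2 (j - 1) = 0\<close> or \<open>2 (k - 2) = 0\<close>, or to compensate a triangle
  at the outer end of a swapped run.\<close>

definition run_swap :: bool where
  "run_swap \<longleftrightarrow> n dvd 2 * c \<and> \<sigma> True = \<sigma> False"

definition hor_flow :: "bool \<Rightarrow> bool" where
  "hor_flow p \<longleftrightarrow> (if p then n dvd 2 * A \<or> run_swap \<and> n dvd A + c + 1
     else n dvd 2 * B \<or> run_swap \<and> n dvd B - c - 1)"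

fun flow :: "side \<Rightarrow> side \<Rightarrow> bool \<Rightarrow> int" where
  "flow (Hor p) (Hor q) s = 0"
| "flow (Hor p) (Run q) s = (if p = q \<and> hor_flow q then if s = \<sigma> q then 1 else -1 else 0)"
| "flow (Run p) (Hor q) s = (if p = q \<and> hor_flow p then if s = \<sigma> p then 1 else -1 else 0)"
| "flow (Run p) (Run q) s = (if p = q \<or> run_swap then if s = \<sigma> p then -1 else 1 else 0)"

text \<open>In a reduced diagram the two 2-cells at an edge never see it at the same position of the same
  relator. The next two conditions are all that is needed of this; in the second one, three
  consecutive edges at a vertex are considered.\<close>

definition unfolded :: "side \<Rightarrow> side \<Rightarrow> bool" where
  "unfolded l r \<longleftrightarrow> (\<forall>p. \<not> (l = Hor p \<and> r = Hor p))"

definition unfolded3 :: "side \<Rightarrow> bool \<Rightarrow> side \<Rightarrow> side \<Rightarrow> side \<Rightarrow> bool \<Rightarrow> bool" where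
  "unfolded3 rx sx ly ry lz sz \<longleftrightarrow>
     (\<forall>p. rx = Hor p \<longrightarrow> ly = Run p \<longrightarrow> ry = Run p \<longrightarrow> lz = Hor p \<longrightarrow> sx \<noteq> sz)"

section \<open>Arithmetic modulo \<open>n\<close>: which short relations can close up around a
  vertex\<close>

lemma not_dvd_1: "\<not> n dvd 1"
  using not_dvd_A dvd_trans one_dvd by blast

lemma shift_of_add3: "shift_of (add3 u v) = shift_of u + shift_of v"
  by (cases u; cases v) (simp add: algebra_simps)

lemma closed_minus: "closed (- a, - b, - k) \<longleftrightarrow> closed (a, b, k)"
proof -
  have "shift_of (- a, - b, - k) = - shift_of (a, b, k)"
    by simp
  then show ?thesis
    by (simp only: closed_def dvd_minus_iff)
qed

lemma even_if_two_torsion: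
  assumes "n dvd 2 * x" "\<not> n dvd x"
  shows "even n"
proof (rule ccontr)
  assume "odd n"
  then have "coprime n 2" by simp
  with assms show False using coprime_dvd_mult_right_iff by blast
qed

text \<open>The residues modulo \<open>n\<close> form a cyclic group, which has at most one element
  of order two.\<close>

lemma two_torsion_unique:
  assumes "n dvd 2 * x" "\<not> n dvd x" "n dvd 2 * y" "\<not> n dvd y"
  shows "n dvd x - y"
proof -
  have odd: "odd u" if "2 * z = n * u" "\<not> n dvd z" for z u
  proof
    assume "even u"
    then obtain a where "u = 2 * a" by (elim evenE)
    with that(1) have "z = n * a" by simp
    with that(2) show False by simp
  qed
  obtain u where u: "2 * x = n * u" using assms(1) by (elim dvdE)
  obtain v where v: "2 * y = n * v" using assms(3) by (elim dvdE)
  have "even (u - v)"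
    using odd[OF u assms(2)] odd[OF v assms(4)] by simp
  then obtain z where z: "u - v = 2 * z" by (elim evenE)
  have "2 * (x - y) = n * (u - v)"
    unfolding right_diff_distrib using u v by simp
  then have "x - y = n * z"
    unfolding z by simp
  then show ?thesis by simp
qed

lemma run_swap_sigma: "run_swap \<Longrightarrow> \<sigma> True = \<sigma> False"
  by (simp add: run_swap_def)

text \<open>One alternative from each side yields either two distinct elements of order two modulo
  \<open>n\<close> or, by addition, \<open>n dvd A + B\<close>.\<close>

lemma hor_flow_excl:
  assumes "hor_flow True"
  shows "\<not> hor_flow False"
proof
  assume "hor_flow False"
  have 1: False if "n dvd 2 * A" "n dvd 2 * B"
    using that two_torsion_unique not_dvd_A not_dvd_B not_dvd_diff by blast
  have 2: False if "n dvd 2 * A" "n dvd 2 * c"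
    using that two_torsion_unique not_dvd_A not_dvd_c not_dvd_A_c by blast
  have 3: False if "n dvd 2 * B" "n dvd 2 * c"
    using that two_torsion_unique[of B "- c"] not_dvd_B not_dvd_c not_dvd_B_c by simp
  have 4: False if "n dvd A + c + 1" "n dvd B - c - 1"
    using dvd_add[OF that] not_dvd_sum by simp
  show False
    using assms \<open>hor_flow False\<close> 1 2 3 4 by (auto simp: hor_flow_def run_swap_def)
qed

text \<open>Up to sign these are the assumed non-divisibilities, except that
  \<open>A - B + c\<close> equals \<open>1\<close>.\<close>

lemma closed_simps:
  "\<not> closed (1,0,0)" "\<not> closed (-1,0,0)" "\<not> closed (0,1,0)" "\<not> closed (0,-1,0)"
  "\<not> closed (0,0,1)" "\<not> closed (0,0,-1)" "\<not> closed (1,-1,0)" "\<not> closed (-1,1,0)"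
  "\<not> closed (1,1,0)" "\<not> closed (-1,-1,0)" "\<not> closed (1,0,-1)" "\<not> closed (-1,0,1)"
  "\<not> closed (0,1,1)" "\<not> closed (0,-1,-1)" "\<not> closed (1,-1,1)" "\<not> closed (-1,1,-1)"
proof -
  show *: "\<not> closed (1,0,0)" "\<not> closed (0,1,0)" "\<not> closed (0,0,1)" "\<not> closed (1,-1,0)"
    "\<not> closed (1,1,0)" "\<not> closed (1,0,-1)" "\<not> closed (0,1,1)" "\<not> closed (1,-1,1)"
    using not_dvd_A not_dvd_B not_dvd_c not_dvd_diff not_dvd_sum not_dvd_A_c not_dvd_B_c not_dvd_1 c_eq
    unfolding closed_def shift_of.simps by simp_all
  show "\<not> closed (-1,0,0)" "\<not> closed (0,-1,0)" "\<not> closed (0,0,-1)" "\<not> closed (-1,1,0)"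
    "\<not> closed (-1,-1,0)" "\<not> closed (-1,0,1)" "\<not> closed (0,-1,-1)" "\<not> closed (-1,1,-1)"
    using closed_minus[of 1 0 0] closed_minus[of 0 1 0] closed_minus[of 0 0 1]
      closed_minus[of 1 "-1" 0] closed_minus[of 1 1 0] closed_minus[of 1 0 "-1"]
      closed_minus[of 0 1 1] closed_minus[of 1 "-1" 1] *
    by simp_all
qed

text \<open>Here \<open>A - B - c = 1 - 2 * c\<close>. A swap makes \<open>2 * c\<close> vanish
  modulo \<open>n\<close> and leaves \<open>1\<close>; otherwise two-torsion makes \<open>n\<close>
  even, and the number is odd.\<close>

lemma not_closed_odd:
  assumes "run_swap \<or> hor_flow True \<or> hor_flow False"
  shows "\<not> closed (1,-1,-1)" "\<not> closed (-1,1,1)"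
proof -
  have "\<not> n dvd 1 - 2 * c"
  proof (cases run_swap)
    case True
    then have "n dvd 2 * c" by (simp add: run_swap_def)
    then show ?thesis using not_dvd_1 dvd_diff_left_iff by blast
  next
    case False
    with assms have "even n"
      using even_if_two_torsion not_dvd_A not_dvd_B by (auto simp: hor_flow_def)
    moreover have "odd (1 - 2 * c)" by simp
    ultimately show ?thesis using dvd_trans by blast
  qed
  moreover have "shift_of (1,-1,-1) = 1 - 2 * c"
    unfolding shift_of.simps using c_eq by simp
  ultimately show "\<not> closed (1,-1,-1)"
    unfolding closed_def by metis
  then show "\<not> closed (-1,1,1)"
    using closed_minus[of 1 "-1" "-1"] by simp
qed

text \<open>The conditions on the flow are chosen for this: it is switched on by the closed
  relations that would leave a vertex of small degree short of angle.\<close>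

lemma closed_imp_hor_flow:
  "closed (2,0,0) \<Longrightarrow> hor_flow True" "closed (-2,0,0) \<Longrightarrow> hor_flow True"
  "closed (0,2,0) \<Longrightarrow> hor_flow False" "closed (0,-2,0) \<Longrightarrow> hor_flow False"
  "closed (0,0,2) \<Longrightarrow> \<sigma> True = \<sigma> False \<Longrightarrow> run_swap" "closed (0,0,-2) \<Longrightarrow> \<sigma> True = \<sigma> False \<Longrightarrow> run_swap"
  "run_swap \<Longrightarrow> closed (2,-1,0) \<Longrightarrow> hor_flow True" "run_swap \<Longrightarrow> closed (-2,1,0) \<Longrightarrow> hor_flow True"
  "run_swap \<Longrightarrow> closed (1,-2,0) \<Longrightarrow> hor_flow False" "run_swap \<Longrightarrow> closed (-1,2,0) \<Longrightarrow> hor_flow False"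
proof -
  show *: "closed (2,0,0) \<Longrightarrow> hor_flow True" "closed (0,2,0) \<Longrightarrow> hor_flow False"
    "closed (0,0,2) \<Longrightarrow> \<sigma> True = \<sigma> False \<Longrightarrow> run_swap"
    by (simp_all add: closed_def hor_flow_def run_swap_def)
  show **: "hor_flow True" if "run_swap" "closed (2,-1,0)"
  proof -
    have "n dvd (2 * A - B) + 2 * c"
      using that by (intro dvd_add) (auto simp: closed_def run_swap_def)
    also have "(2 * A - B) + 2 * c = A + c + 1" using c_eq by simp
    finally show ?thesis using that by (simp add: hor_flow_def)
  qed
  show ***: "hor_flow False" if "run_swap" "closed (1,-2,0)"
  proof -
    have "n dvd - (A - 2 * B) - 2 * c"
      using that unfolding closed_def run_swap_def dvd_minus_iff
      by (intro dvd_diff, subst dvd_minus_iff) simp_all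
    also have "- (A - 2 * B) - 2 * c = B - c - 1" using c_eq by simp
    finally show ?thesis using that by (simp add: hor_flow_def)
  qed
  show "closed (-2,0,0) \<Longrightarrow> hor_flow True" "closed (0,-2,0) \<Longrightarrow> hor_flow False"
    "closed (0,0,-2) \<Longrightarrow> \<sigma> True = \<sigma> False \<Longrightarrow> run_swap"
    "run_swap \<Longrightarrow> closed (-2,1,0) \<Longrightarrow> hor_flow True" "run_swap \<Longrightarrow> closed (-1,2,0) \<Longrightarrow> hor_flow False"
    using * ** *** closed_minus[of 2 0 0] closed_minus[of 0 2 0] closed_minus[of 0 0 2]
      closed_minus[of 2 "-1" 0] closed_minus[of 1 "-2" 0] by simp_all
qed

section \<open>Symmetry of the flow and of the corners\<close>

lemma flow_ge: "flow l r s \<ge> -1"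
  by (cases l; cases r) auto

text \<open>Reversing an edge exchanges its two 2-cells and negates its sign, so angle only moves
  between the two ends.\<close>

lemma flow_swap: "flow r l (\<not> s) = - flow l r s"
  using run_swap_sigma by (cases l rule: side_cases; cases r rule: side_cases) auto

lemma turn_swap: "shift_of (turn r' r) = - shift_of (turn r r')"
  by (cases r; cases r') auto

lemma corner_sym:
  assumes "corner r x r' y"
  shows "corner r' y r x"
proof -
  have "signs_match r' (snd y) r (snd x)"
    using assms by (cases r; cases r') (auto simp: corner_def)
  moreover have "n dvd - (fst y - fst x - shift_of (turn r r'))"
    using assms unfolding corner_def dvd_minus_iff by simp
  moreover have "- (fst y - fst x - shift_of (turn r r')) = fst x - fst y - shift_of (turn r' r)"
    by (simp add: turn_swap[of r' r])
  ultimately show ?thesis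
    by (simp only: corner_def)
qed

text \<open>In the following case distinctions the signs are split first, as the simplifier loops on
  equations between boolean variables.\<close>

lemma three_losses:
  assumes "signs_match rx sx ly sy" "signs_match ry sy lz sz"
    "flow lx rx sx = -1" "flow ly ry sy = -1" "flow lz rz sz = -1"
    "unfolded3 rx sx ly ry lz sz"
  shows "rx = ly \<or> ry = lz"
  by (rule ccontr, insert assms[unfolded unfolded3_def all_bool_eq] hor_flow_excl run_swap_sigma,
    cases "\<sigma> True"; cases "\<sigma> False"; cases sx; cases sy; cases sz; simp?;
    cases rx rule: side_cases; cases ly rule: side_cases; simp?;
    cases ry rule: side_cases; cases lz rule: side_cases; simp?;
    cases lx rule: side_cases; simp split: if_splits;
    cases rz rule: side_cases; simp split: if_splits)

text \<open>If both corners have weight \<open>2\<close>, both edges must gain \<open>1\<close>.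
  \<open>closed_simps\<close> discards impossible combinations, and
  \<open>closed_imp_hor_flow\<close> supplies the gains in others.\<close>

lemma vertex2:
  assumes "signs_match rx sx ly sy" "signs_match ry sy lx sx"
    and "closed (add3 (turn rx ly) (turn ry lx))"
    and "unfolded lx rx" "unfolded ly ry"
  shows "6 \<le> corner_weight rx ly + corner_weight ry lx + flow lx rx sx + flow ly ry sy"
  by (rule ccontr, insert assms[unfolded unfolded_def all_bool_eq] run_swap_sigma,
    cases "\<sigma> True"; cases "\<sigma> False"; cases sx; cases sy; simp?;
    cases rx rule: side_cases; cases ly rule: side_cases; simp?;
    cases ry rule: side_cases; cases lx rule: side_cases;
    simp add: corner_weight_def closed_simps closed_imp_hor_flow hor_flow_excl split: if_splits)

text \<open>Three corners alone weigh at least \<open>6\<close>, so only a loss can do harm; a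
  rotation puts one first.\<close>

lemma vertex3_loss:
  assumes "signs_match rx sx ly sy" "signs_match ry sy lz sz" "signs_match rz sz lx sx"
    and "closed (add3 (turn rx ly) (add3 (turn ry lz) (turn rz lx)))"
    and "flow lx rx sx = -1"
  shows "6 \<le> corner_weight rx ly + corner_weight ry lz + corner_weight rz lx
     + flow lx rx sx + flow ly ry sy + flow lz rz sz"
  by (rule ccontr, insert assms run_swap_sigma,
    cases "\<sigma> True"; cases "\<sigma> False"; cases sx; cases sy; cases sz; simp?;
    cases lx rule: side_cases; cases rx rule: side_cases; simp split: if_splits;
    cases ly rule: side_cases; simp?; cases rz rule: side_cases; simp?;
    cases ry rule: side_cases; cases lz rule: side_cases;
    simp add: corner_weight_def closed_simps closed_imp_hor_flow not_closed_odd hor_flow_excl split: if_splits)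

lemma vertex3:
  assumes "signs_match rx sx ly sy" "signs_match ry sy lz sz" "signs_match rz sz lx sx"
    and "n dvd shift_of (turn rx ly) + shift_of (turn ry lz) + shift_of (turn rz lx)"
  shows "6 \<le> corner_weight rx ly + corner_weight ry lz + corner_weight rz lx
     + flow lx rx sx + flow ly ry sy + flow lz rz sz"
proof -
  have weight: "2 \<le> corner_weight r r'" for r r'
    by (simp add: corner_weight_def)
  consider "flow lx rx sx = -1" | "flow ly ry sy = -1" | "flow lz rz sz = -1"
    | "0 \<le> flow lx rx sx" "0 \<le> flow ly ry sy" "0 \<le> flow lz rz sz"
    using flow_ge[of lx rx sx] flow_ge[of ly ry sy] flow_ge[of lz rz sz] by linarith
  then show ?thesis
  proof cases
    case 1
    then show ?thesis
      using vertex3_loss[of rx sx ly sy ry lz sz rz lx] assms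
      by (simp add: closed_def shift_of_add3 add_ac)
  next
    case 2
    then show ?thesis
      using vertex3_loss[of ry sy lz sz rz lx sx rx ly] assms
      by (simp add: closed_def shift_of_add3 add_ac)
  next
    case 3
    then show ?thesis
      using vertex3_loss[of rz sz lx sx rx ly sy ry lz] assms
      by (simp add: closed_def shift_of_add3 add_ac)
  next
    case 4
    then show ?thesis
      using weight[of rx ly] weight[of ry lz] weight[of rz lx] by linarith
  qed
qed

text \<open>The sequences run around a vertex of degree \<open>m\<close>: \<open>x i\<close> labels
  an edge leaving it, \<open>l i\<close> and \<open>r i\<close> are its syllables in its two
  2-cells, and the next corner lies between \<open>r i\<close> and \<open>l (Suc i)\<close>.\<close>

lemma vertex_weight:
  fixes l r :: "nat \<Rightarrow> side" and x :: "nat \<Rightarrow> int letter" and m :: nat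
  assumes "0 < m"
    and period: "\<And>i. l (i + m) = l i" "\<And>i. r (i + m) = r i" "\<And>i. x (i + m) = x i"
    and corner: "\<And>i. corner (r i) (x i) (l (Suc i)) (x (Suc i))"
    and unfolded: "\<And>i. unfolded (l i) (r i)"
    and unfolded3: "\<And>i. unfolded3 (r i) (snd (x i)) (l (Suc i)) (r (Suc i))
      (l (Suc (Suc i))) (snd (x (Suc (Suc i))))"
  shows "6 \<le> (\<Sum>i<m. corner_weight (r i) (l (Suc i)) + flow (l i) (r i) (snd (x i)))"
proof -
  define v where "v i = corner_weight (r i) (l (Suc i))" for i
  define f where "f i = flow (l i) (r i) (snd (x i))" for i
  have match: "signs_match (r i) (snd (x i)) (l (Suc i)) (snd (x (Suc i)))" for i
    using corner by (simp add: corner_def)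
  define s where "s i = shift_of (turn (r i) (l (Suc i)))" for i
  have "\<exists>k. fst (x (Suc i)) - fst (x i) - s i = n * k" for i
    using corner[of i] by (simp add: corner_def s_def dvd_def)
  then obtain k where k: "fst (x (Suc i)) - fst (x i) - s i = n * k i" for i
    by metis
  have v: "v i = 2 \<or> v i = 3" for i
    by (simp add: v_def corner_weight_def)
  have f: "f i = -1 \<or> 0 \<le> f i" for i
    using flow_ge[of "l i" "r i" "snd (x i)"] by (auto simp: f_def)
  have v_ge: "2 \<le> v i" and f_ge: "-1 \<le> f i" for i
    using v[of i] f[of i] by linarith+
  have f_period: "f (i + m) = f i" for i
    by (simp add: f_def period)
  have v_period: "v (i + m) = v i" for i
    using period(1)[of "Suc i"] by (simp add: v_def period(2))
  \<comment> \<open>Two corners weigh at least \<open>4\<close>, so only three losses could go below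
    \<open>2\<close>; then \<open>three_losses\<close> makes one corner weigh
    \<open>3\<close>.\<close>
  have loss: "2 \<le> v i + v j + f i + f j + f j'" if j: "j = Suc i" "j' = Suc j" for i j j'
  proof (cases "f i = -1 \<and> f j = -1 \<and> f j' = -1")
    case True
    then have "v i = 3 \<or> v j = 3"
      using three_losses[OF match match _ _ _ unfolded3, of "l i" i "r (Suc (Suc i))"]
      unfolding j by (auto simp: v_def f_def corner_weight_def)
    then show ?thesis using True v[of i] v[of j] by linarith
  next
    case False
    then have "f i + f j + f j' \<ge> -2"
      using f[of i] f[of j] f[of j'] by linarith
    then show ?thesis using v[of i] v[of j] by linarith
  qed
  consider "m = 1" | "m = 2" | "m = 3" | "m = 4" | "m = 5" | "6 \<le> m"
    using \<open>0 < m\<close> by linarith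
  then have "6 \<le> (\<Sum>i<m. v i + f i)"
  proof cases
    case 1
    then have "l (Suc 0) = l 0" "x (Suc 0) = x 0"
      using period[of 0] by auto
    then have "signs_match (r 0) (snd (x 0)) (l 0) (snd (x 0))" "s 0 = - (n * k 0)"
      "s 0 = shift_of (turn (r 0) (l 0))"
      using match[of 0] k[of 0] s_def[of 0] by auto
    then have "signs_match (r 0) (snd (x 0)) (l 0) (snd (x 0))" "closed (turn (r 0) (l 0))"
      by (auto simp: closed_def)
    then show ?thesis
      using closed_simps by (cases "r 0" rule: side_cases; cases "l 0" rule: side_cases) auto
  next
    case 2
    then have p: "l (Suc (Suc 0)) = l 0" "x (Suc (Suc 0)) = x 0"
      using period[of 0] by (simp_all add: numeral_2_eq_2)
    \<comment> \<open>The subscripts return after one turn around the vertex, so the shifts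
      telescope.\<close>
    have "s 0 + s 1 = n * (- k 0 - k 1)"
      unfolding right_diff_distrib mult_minus_right using k[of 0] k[of 1] p by simp
    then have "n dvd s 0 + s 1" by simp
    then have "closed (add3 (turn (r 0) (l 1)) (turn (r 1) (l 0)))"
      using p by (simp add: closed_def shift_of_add3 s_def)
    then have "6 \<le> v 0 + v 1 + f 0 + f 1"
      using vertex2[of "r 0" "snd (x 0)" "l 1" "snd (x 1)" "r 1" "l 0"] match[of 0] match[of 1] p unfolded
      by (simp add: v_def f_def)
    then show ?thesis using 2 by (simp add: numeral_2_eq_2)
  next
    case 3
    then have p: "l (Suc (Suc (Suc 0))) = l 0" "x (Suc (Suc (Suc 0))) = x 0"
      using period[of 0] by (simp_all add: numeral_3_eq_3)
    have "s 0 + s 1 + s 2 = n * (- k 0 - k 1 - k 2)"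
      unfolding right_diff_distrib mult_minus_right
      using k[of 0] k[of 1] k[of 2] p by (simp add: numeral_2_eq_2)
    then have "n dvd s 0 + s 1 + s 2" by simp
    then have "n dvd shift_of (turn (r 0) (l 1)) + shift_of (turn (r 1) (l 2)) + shift_of (turn (r 2) (l 0))"
      using p by (simp add: s_def numeral_2_eq_2)
    then have "6 \<le> v 0 + v 1 + v 2 + f 0 + f 1 + f 2"
      using vertex3[of "r 0" "snd (x 0)" "l 1" "snd (x 1)" "r 1" "l 2" "snd (x 2)" "r 2" "l 0"]
        match[of 0] match[of 1] match[of 2] p
      by (simp add: v_def f_def numeral_2_eq_2)
    then show ?thesis using 3 by (simp add: numeral_3_eq_3 numeral_2_eq_2)
  next
    case 4
    then have p: "f 4 = f 0" "f 5 = f 1" "v 4 = v 0"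
      using f_period[of 0] f_period[of 1] v_period[of 0] by simp_all
    have "(\<Sum>i<m. v i + f i) = v 0 + v 1 + v 2 + v 3 + f 0 + f 1 + f 2 + f 3"
      using 4 by (simp add: eval_nat_numeral)
    moreover have "2 \<le> v 0 + v 1 + f 0 + f 1 + f 2" "2 \<le> v 1 + v 2 + f 1 + f 2 + f 3"
      "2 \<le> v 2 + v 3 + f 2 + f 3 + f 0" "2 \<le> v 3 + v 0 + f 3 + f 0 + f 1"
      using loss[of 1 0 2] loss[of 2 1 3] loss[of 3 2 4] loss[of 4 3 5] p by simp_all
    moreover have "8 \<le> v 0 + v 1 + v 2 + v 3" "-4 \<le> f 0 + f 1 + f 2 + f 3"
      using v_ge[of 0] v_ge[of 1] v_ge[of 2] v_ge[of 3] f_ge[of 0] f_ge[of 1] f_ge[of 2] f_ge[of 3]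
      by linarith+
    \<comment> \<open>Adding the four cyclic instances of \<open>loss\<close> counts each corner
      twice and each flow three times. Integrality matters for \<open>F = -3\<close>.\<close>
    moreover have "6 \<le> V + F" if "8 \<le> 2 * V + 3 * F" "8 \<le> V" "-4 \<le> F" for V F :: int
      using that by presburger
    ultimately show ?thesis
      by (smt (verit))
  next
    case 5
    then have "(\<Sum>i<m. v i + f i) = v 0 + v 1 + v 2 + v 3 + v 4 + f 0 + f 1 + f 2 + f 3 + f 4"
      by (simp add: eval_nat_numeral)
    moreover have "2 \<le> v 0 + v 1 + f 0 + f 1 + f 2"
      using loss[of 1 0 2] by simp
    ultimately show ?thesis
      using v_ge[of 2] v_ge[of 3] v_ge[of 4] f_ge[of 3] f_ge[of 4] by linarith
  next
    case 6
    have "1 \<le> v i + f i" for i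
      using v[of i] f[of i] by linarith
    then have "(\<Sum>i<m. 1) \<le> (\<Sum>i<m. v i + f i)"
      by (intro sum_mono)
    then show ?thesis using 6 by simp
  qed
  then show ?thesis by (simp add: v_def f_def)
qed

end

section \<open>Total curvature of a cell decomposition\<close>

lemma sum_orbits:
  fixes g :: "'a \<Rightarrow> int"
  assumes "f permutes D" "finite D"
  shows "(\<Sum>X\<in>orbit f ` D. sum g X) = sum g D"
proof -
  have perm: "permutation f"
    using assms permutation_permutes by blast
  have "\<Union> (orbit f ` D) = D"
    using permutes_orbit_subset[OF assms(1)] permutation_self_in_orbit[OF perm] by blast
  moreover have "X = Y" if "X \<in> orbit f ` D" "Y \<in> orbit f ` D" "z \<in> X" "z \<in> Y" for X Y z
    using that orbit_cyclic_eq3[OF cyclic_on_orbit'[OF perm]] by (metis (no_types, lifting) imageE)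
  moreover have "finite X" if "X \<in> orbit f ` D" for X
    using that by (auto intro: finite_orbit permutation_self_in_orbit[OF perm])
  ultimately show ?thesis
    using sum.Union_disjoint[of "orbit f ` D" g] by (metis disjoint_iff comp_apply)
qed

lemma sum_orbit_funpow:
  assumes "permutation f"
  shows "\<exists>m>0. (f ^^ m) x = x \<and> (\<forall>g :: 'a \<Rightarrow> int. sum g (orbit f x) = (\<Sum>i<m. g ((f ^^ i) x)))"
proof (intro exI conjI allI)
  let ?m = "funpow_dist1 f x x"
  have x: "x \<in> orbit f x"
    by (rule permutation_self_in_orbit[OF assms])
  show "0 < ?m" by simp
  show "(f ^^ ?m) x = x"
    by (rule funpow_dist1_prop[OF x])
  show "sum g (orbit f x) = (\<Sum>i<?m. g ((f ^^ i) x))" for g :: "'a \<Rightarrow> int"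
    unfolding orbit_conv_funpow_dist1[OF x]
    using sum.reindex[OF inj_on_funpow_dist1[OF x]] by (simp add: lessThan_atLeast0)
qed

context sphere_decomposition
begin

lemma opp_in: "d \<in> D \<Longrightarrow> opp d \<in> D"
  and nxt_in: "d \<in> D \<Longrightarrow> nxt d \<in> D"
  using permutes_in_image[OF opp_permutes] permutes_in_image[OF nxt_permutes] by simp_all

lemma permutation_nxt: "permutation nxt"
  using nxt_permutes finite_D permutation_permutes by blast

lemma vertex_permutes: "nxt \<circ> opp permutes D"
  using permutes_compose[OF opp_permutes nxt_permutes] .

lemma permutation_vertex: "permutation (nxt \<circ> opp)"
  using vertex_permutes finite_D permutation_permutes by blast

lemma card_edges: "card D = 2 * card (orbit opp ` D)"
proof -
  have "card (orbit opp d) = 2" if "d \<in> D" for d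
  proof -
    have "orbit opp d = {(opp ^^ i) d | i. i < 2}"
      using opp_opp[OF that] by (intro orbit_altdef_bounded) (simp_all add: numeral_2_eq_2)
    also have "\<dots> = {d, opp d}"
      by (auto simp: less_2_cases_iff intro: exI[of _ 0] exI[of _ 1])
    finally show ?thesis using opp_neq[OF that] by simp
  qed
  then have "(\<Sum>X\<in>orbit opp ` D. \<Sum>d\<in>X. 1) = (\<Sum>X\<in>orbit opp ` D. 2 :: int)"
    by (intro sum.cong) auto
  then show ?thesis
    using sum_orbits[OF opp_permutes finite_D, of "\<lambda>_. 1"] by simp
qed

text \<open>With \<open>V\<close>, \<open>E\<close>, \<open>F\<close> the numbers of vertices, edges
  and 2-cells, \<open>6 * V + 6 * F\<close> is at most \<open>3 * card D = 6 * E\<close>, against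
  Euler's formula.\<close>

lemma curvature_contradiction:
  fixes g h :: "'d \<Rightarrow> int"
  assumes vertex: "\<And>d. d \<in> D \<Longrightarrow> 6 \<le> sum g (orbit (nxt \<circ> opp) d)"
    and face: "\<And>d. d \<in> D \<Longrightarrow> 6 \<le> sum h (orbit nxt d)"
    and total: "sum g D + sum h D \<le> 3 * int (card D)"
  shows False
proof -
  have "6 * int (card (orbit (nxt \<circ> opp) ` D)) \<le> sum g D"
    unfolding sum_orbits[OF vertex_permutes finite_D, of g, symmetric]
    using sum_mono[of "orbit (nxt \<circ> opp) ` D" "\<lambda>_. 6" "sum g"] vertex by force
  moreover have "6 * int (card (orbit nxt ` D)) \<le> sum h D"
    unfolding sum_orbits[OF nxt_permutes finite_D, of h, symmetric]
    using sum_mono[of "orbit nxt ` D" "\<lambda>_. 6" "sum h"] face by force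
  ultimately show False
    using euler_characteristic total card_edges by linarith
qed

end

section \<open>Diagrams over the cyclic presentation\<close>

lemma inv_letter_inv_letter [simp]: "inv_letter (inv_letter a) = a"
  by (simp add: inv_letter_def)

lemma shift_pow_append: "(shift n ^^ i) (u @ v) = (shift n ^^ i) u @ (shift n ^^ i) v"
  by (induction i) (simp_all add: shift_def)

lemma shift_pow_gen_power: "(shift n ^^ i) (gen_power (gen n a) e) = gen_power (gen n (a + int i)) e"
proof (induction i)
  case (Suc i)
  then show ?case
    by (simp add: shift_def gen_power_def gen_def mod_simps algebra_simps)
qed simp

lemma inv_word_gen_power: "inv_word (gen_power x e) = replicate (nat \<bar>e\<bar>) (x, \<not> 0 < e)"
  by (simp add: inv_word_def gen_power_def inv_letter_def)

lemma inv_word_append: "inv_word (u @ v) = inv_word v @ inv_word u"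
  by (simp add: inv_word_def)

text \<open>The sign for \<open>False\<close> is negated because the outer end of the second power
  is its last letter.\<close>

locale cyclic_diagram =
  spherical_diagram "cyclic_presentation n w" D opp nxt lab cell pos pos_or +
  link_parameters "int n" "j - 1" "k - 2" "k - j" "\<lambda>p. if p then 0 < t else \<not> 0 < m"
  for n :: nat and w :: "int word" and D :: "nat set" and opp nxt :: "nat \<Rightarrow> nat"
    and lab :: "nat \<Rightarrow> int letter" and cell pos :: "nat \<Rightarrow> nat" and pos_or :: "nat \<Rightarrow> bool"
    and j k t m :: int +
  assumes w_eq: "w = gen_power (gen n j) t @ gen_power (gen n k) m"
    and t_neq: "t \<noteq> 0" and m_neq: "m \<noteq> 0"
    and is_reduced: "reduced"
begin

definition len_t :: nat where "len_t = nat \<bar>t\<bar>"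
definition len_m :: nat where "len_m = nat \<bar>m\<bar>"

definition len :: nat where "len = 2 * len_t + 2 * len_m + 2"

lemma len_t_pos: "0 < len_t" and len_m_pos: "0 < len_m"
  using t_neq m_neq by (simp_all add: len_t_def len_m_def)

definition role :: "nat \<Rightarrow> side" where
  "role i = (if i = 0 then Hor True else if i \<le> len_t then Run True else if i \<le> len_t + len_m then Run False
     else if i = len_t + len_m + 1 then Hor False else if i \<le> len_t + 2 * len_m + 1 then Run False else Run True)"

definition sgn_at :: "nat \<Rightarrow> bool" where
  "sgn_at i \<longleftrightarrow> (if i = 0 then True else if i \<le> len_t then 0 < t else if i \<le> len_t + len_m then 0 < m
     else if i = len_t + len_m + 1 then False else if i \<le> len_t + 2 * len_m + 1 then \<not> 0 < m else \<not> 0 < t)"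

fun offset :: "side \<Rightarrow> int" where
  "offset (Hor b) = (if b then 0 else 1)"
| "offset (Run b) = (if b then j - 1 else k - 1)"

lemma relator_eq:
  assumes "1 \<le> i"
  shows "relator (cyclic_presentation n w) i =
    (gen n (int i), True) # replicate len_t (gen n (int i + (j - 1)), 0 < t)
      @ replicate len_m (gen n (int i + (k - 1)), 0 < m)
      @ (gen n (int i + 1), False) # replicate len_m (gen n (int i + (k - 1)), \<not> 0 < m)
      @ replicate len_t (gen n (int i + (j - 1)), \<not> 0 < t)"
proof -
  have "(shift n ^^ (i - 1)) w = gen_power (gen n (int i + (j - 1))) t @ gen_power (gen n (int i + (k - 1))) m"
    using assms by (simp add: w_eq shift_pow_append shift_pow_gen_power of_nat_diff algebra_simps)
  then show ?thesis
    by (simp add: cyclic_presentation_def inv_word_append inv_word_gen_power len_t_def len_m_def)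
      (simp add: gen_power_def)
qed

lemma length_relator: "1 \<le> i \<Longrightarrow> length (relator (cyclic_presentation n w) i) = len"
  by (simp add: relator_eq len_def)

lemma relator_nth:
  assumes "1 \<le> i" "a < len"
  shows "relator (cyclic_presentation n w) i ! a = (gen n (int i + offset (role a)), sgn_at a)"
  using assms(2) len_t_pos len_m_pos unfolding relator_eq[OF assms(1)]
  by (auto simp: nth_append nth_Cons' role_def sgn_at_def len_def)

text \<open>\<open>signs_match\<close> excludes pairs of syllables that are never adjacent, for
  which \<open>turn\<close> has arbitrary values.\<close>

lemma turn_offset: "signs_match r s r' s' \<Longrightarrow> shift_of (turn r r') = offset r' - offset r"
  by (cases r rule: side_cases; cases r' rule: side_cases) simp_all

lemma role_succ:
  assumes "a < len"
  shows "signs_match (role a) (\<not> sgn_at a) (role ((a + 1) mod len)) (sgn_at ((a + 1) mod len))"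
proof -
  consider "a = 0" | "0 < a" "a < len_t" | "a = len_t" | "len_t < a" "a < len_t + len_m" | "a = len_t + len_m" | "a = len_t + len_m + 1"
    | "len_t + len_m + 1 < a" "a < len_t + 2 * len_m + 1" | "a = len_t + 2 * len_m + 1"
    | "len_t + 2 * len_m + 1 < a" "a < 2 * len_t + 2 * len_m + 1" | "a = 2 * len_t + 2 * len_m + 1"
    using assms unfolding len_def by linarith
  then show ?thesis
    by cases (use len_t_pos len_m_pos in \<open>auto simp: role_def sgn_at_def len_def\<close>)
qed

lemma corner_relator:
  assumes "1 \<le> i" "a < len"
  defines "R \<equiv> relator (cyclic_presentation n w) i"
  shows "corner (role a) (inv_letter (R ! a)) (role ((a + 1) mod len)) (R ! ((a + 1) mod len))"
proof -
  have a': "(a + 1) mod len < len" by (simp add: len_def)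
  have "x mod int n - y mod int n - (x - y) = int n * (y div int n - x div int n)" for x y :: int
    using div_mult_mod_eq[of x "int n"] div_mult_mod_eq[of y "int n"] by (simp add: algebra_simps)
  then have "int n dvd x mod int n - y mod int n - (x - y)" for x y :: int
    by simp
  then have "int n dvd gen n (int i + u) - gen n (int i + v) - (u - v)" for u v
    unfolding gen_def by (metis add_diff_cancel_left)
  then show ?thesis
    unfolding corner_def R_def relator_nth[OF assms(1,2)] relator_nth[OF assms(1) a'] inv_letter_def
    using role_succ[OF assms(2)] turn_offset[OF role_succ[OF assms(2)]] by simp
qed

section \<open>Transfer to the edges of a diagram\<close>

definition side_at :: "nat \<Rightarrow> side" where
  "side_at d = role (pos d)"

lemma cell_bounds: "d \<in> D \<Longrightarrow> 1 \<le> cell d \<and> cell d \<le> n"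
  using cell_index by (fastforce simp: cyclic_presentation_def)

lemma length_cell: "d \<in> D \<Longrightarrow> length (relator (cyclic_presentation n w) (cell d)) = len"
  using cell_bounds length_relator by blast

lemma pos_len: "d \<in> D \<Longrightarrow> pos d < len"
  using pos_less length_cell by metis

lemma lab_eq: "d \<in> D \<Longrightarrow> lab d = (gen n (int (cell d) + offset (side_at d)), pos_or d = sgn_at (pos d))"
  using lab_pos[of d] relator_nth[of "cell d" "pos d"] cell_bounds[of d] pos_len[of d]
  by (auto simp: inv_letter_def side_at_def)

lemma pos_nxt_eq: "d \<in> D \<Longrightarrow>
    pos (nxt d) = (if pos_or d then (pos d + 1) mod len else (pos d + len - 1) mod len)"
  using pos_nxt length_cell by (simp add: Let_def)

lemma pos_nxt_or: "d \<in> D \<Longrightarrow> pos_or d \<Longrightarrow> pos (nxt d) = (pos d + 1) mod len"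
  using pos_nxt_eq by simp

lemma pos_nxt_not_or:
  assumes "d \<in> D" "\<not> pos_or d"
  shows "pos d = (pos (nxt d) + 1) mod len"
proof -
  have "(pos (nxt d) + 1) mod len = (pos d + len - 1 + 1) mod len"
    using pos_nxt_eq[OF assms(1)] assms(2) by (simp only: if_False mod_add_left_eq)
  also have "pos d + len - 1 + 1 = pos d + len"
    by (simp add: len_def)
  also have "\<dots> mod len = pos d"
    using pos_len[OF assms(1)] by simp
  finally show ?thesis by simp
qed

lemma corner_nxt:
  assumes "d \<in> D"
  shows "corner (side_at d) (inv_letter (lab d)) (side_at (nxt d)) (lab (nxt d))"
proof -
  define R where "R = relator (cyclic_presentation n w) (cell d)"
  have R: "R = relator (cyclic_presentation n w) (cell (nxt d))"
    by (simp only: R_def cell_nxt[OF assms])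
  have corner: "corner (role a) (inv_letter (R ! a)) (role ((a + 1) mod len)) (R ! ((a + 1) mod len))"
    if "a < len" for a
    unfolding R_def using corner_relator[OF conjunct1[OF cell_bounds[OF assms]] that] .
  have lab: "lab d = (if pos_or d then R ! pos d else inv_letter (R ! pos d))"
    using lab_pos[OF assms] by (simp only: R_def)
  have lab': "lab (nxt d) = (if pos_or d then R ! pos (nxt d) else inv_letter (R ! pos (nxt d)))"
    using lab_pos[OF nxt_in[OF assms]] by (simp only: R pos_or_nxt[OF assms])
  show ?thesis
  proof (cases "pos_or d")
    case True
    have "corner (role (pos d)) (inv_letter (R ! pos d)) (role (pos (nxt d))) (R ! pos (nxt d))"
      unfolding pos_nxt_or[OF assms True] by (rule corner[OF pos_len[OF assms]])
    then show ?thesis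
      using True by (simp only: lab lab' side_at_def if_True)
  next
    case False
    have "corner (role (pos (nxt d))) (inv_letter (R ! pos (nxt d))) (role (pos d)) (R ! pos d)"
      using corner[OF pos_len[OF nxt_in[OF assms]]] unfolding pos_nxt_not_or[OF assms False, symmetric] .
    from corner_sym[OF this] show ?thesis
      using False by (simp only: lab lab' side_at_def if_False inv_letter_inv_letter)
  qed
qed

text \<open>Reducedness enters here. Equal positions and inverse labels force opposite orientations
  and relator indices congruent modulo \<open>n\<close>; indices in \<open>1..n\<close> are then
  equal, so the edge would be folded.\<close>

lemma pos_opp:
  assumes "d \<in> D"
  shows "pos (opp d) \<noteq> pos d"
proof
  assume pos: "pos (opp d) = pos d"
  then have side: "side_at (opp d) = side_at d" by (simp add: side_at_def)
  have "snd (lab d) \<longleftrightarrow> pos_or d = sgn_at (pos d)"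
    "snd (lab (opp d)) \<longleftrightarrow> pos_or (opp d) = sgn_at (pos d)"
    by (simp_all only: lab_eq[OF assms] lab_eq[OF opp_in[OF assms]] pos snd_conv)
  moreover have "snd (lab (opp d)) \<longleftrightarrow> \<not> snd (lab d)"
    by (simp only: lab_opp[OF assms] inv_letter_def snd_conv)
  ultimately have or: "pos_or (opp d) \<noteq> pos_or d"
    by blast
  have "fst (lab d) = gen n (int (cell d) + offset (side_at d))"
    "fst (lab (opp d)) = gen n (int (cell (opp d)) + offset (side_at d))"
    by (simp_all only: lab_eq[OF assms] lab_eq[OF opp_in[OF assms]] side fst_conv)
  moreover have "fst (lab (opp d)) = fst (lab d)"
    by (simp only: lab_opp[OF assms] inv_letter_def fst_conv)
  ultimately have "gen n (int (cell (opp d)) + offset (side_at d)) = gen n (int (cell d) + offset (side_at d))"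
    by metis
  then have "int n dvd (int (cell (opp d)) + offset (side_at d)) - (int (cell d) + offset (side_at d))"
    unfolding gen_def by (simp only: mod_eq_dvd_iff)
  then have "int n dvd int (cell (opp d)) - int (cell d)" by simp
  moreover have "\<bar>int (cell (opp d)) - int (cell d)\<bar> < \<bar>int n\<bar>"
    using cell_bounds[OF assms] cell_bounds[OF opp_in[OF assms]] by linarith
  ultimately have "int (cell (opp d)) - int (cell d) = 0"
    by (metis dvd_imp_le_int not_le)
  then have cell: "cell (opp d) = cell d" by simp
  have "pos_or x = pos_or d \<and> x \<in> D" if "x \<in> orbit nxt d" for x
    using that by induction (use assms pos_or_nxt nxt_in in auto)
  moreover have "opp d \<in> orbit nxt (opp d)"
    by (rule permutation_self_in_orbit[OF permutation_nxt])
  ultimately have "orbit nxt d \<noteq> orbit nxt (opp d)"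
    using or by metis
  then have "folds_over d"
    using cell or pos by (simp add: folds_over_def)
  then show False
    using is_reduced assms by (simp add: reduced_def)
qed

lemma hor_pos: "d \<in> D \<Longrightarrow> side_at d = Hor b \<Longrightarrow> pos d = (if b then 0 else len_t + len_m + 1)"
  by (auto simp: side_at_def role_def split: if_splits)

lemma unfolded_at: "d \<in> D \<Longrightarrow> unfolded (side_at d) (side_at (opp d))"
  unfolding unfolded_def using hor_pos pos_opp opp_in by metis

text \<open>The 2-cells on both sides of the middle edge \<open>d1\<close> would meet the same
  \<open>Hor\<close> letter next to it, with opposite orientations, and hence see \<open>d1\<close>
  at the same position.\<close>

lemma unfolded3_at:
  assumes "d \<in> D"
  defines "d1 \<equiv> nxt (opp d)"
  defines "d2 \<equiv> nxt (opp d1)"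
  shows "unfolded3 (side_at (opp d)) (snd (lab d)) (side_at d1) (side_at (opp d1)) (side_at d2) (snd (lab d2))"
  unfolding unfolded3_def
proof (intro allI impI notI)
  fix b
  assume hor: "side_at (opp d) = Hor b" "side_at d2 = Hor b" and signs: "snd (lab d) = snd (lab d2)"
  have D: "opp d \<in> D" "d1 \<in> D" "opp d1 \<in> D" "d2 \<in> D"
    using assms opp_in nxt_in by auto
  have pos: "pos (opp d) = pos d2"
    using hor D hor_pos by metis
  have "pos_or (opp d1) = pos_or d2"
    using pos_or_nxt[OF D(3)] by (simp add: d2_def)
  moreover have "snd (lab d) \<noteq> snd (lab (opp d))"
    using lab_opp[OF assms(1)] by (simp add: inv_letter_def)
  ultimately have or: "pos_or (opp d1) \<noteq> pos_or (opp d)"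
    using lab_eq[OF D(1)] lab_eq[OF D(4)] pos signs by auto
  have "pos (opp d1) = pos d1"
  proof (cases "pos_or (opp d)")
    case True
    then show ?thesis
      using or pos pos_nxt_or[OF D(1)] pos_nxt_not_or[OF D(3)] by (simp add: d1_def d2_def)
  next
    case False
    then have "(pos (opp d1) + 1) mod len = (pos d1 + 1) mod len"
      using or pos pos_nxt_not_or[OF D(1)] pos_nxt_or[OF D(3)] by (simp add: d1_def d2_def)
    then show ?thesis
      using pos_len[OF D(2)] pos_len[OF D(3)] by (simp add: mod_Suc split: if_splits)
  qed
  then show False using pos_opp[OF D(2)] by simp
qed

section \<open>Vertex sums, face sums and their total\<close>

definition corner_value :: "nat \<Rightarrow> int" where
  "corner_value d = corner_weight (side_at (opp d)) (side_at (nxt (opp d)))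
     + flow (side_at d) (side_at (opp d)) (snd (lab d))"

text \<open>Three times the exterior angle: \<open>3\<close> minus the weight of the corner.\<close>

definition turning :: "nat \<Rightarrow> int" where
  "turning d = (if side_at d = side_at (nxt d) then 0 else 1)"

lemma vertex_value:
  assumes "d \<in> D"
  shows "6 \<le> sum corner_value (orbit (nxt \<circ> opp) d)"
proof -
  let ?f = "nxt \<circ> opp"
  obtain l where l: "0 < l" "(?f ^^ l) d = d"
    "\<And>g :: nat \<Rightarrow> int. sum g (orbit ?f d) = (\<Sum>i<l. g ((?f ^^ i) d))"
    using sum_orbit_funpow[OF permutation_vertex, of d] by blast
  have D: "(?f ^^ i) d \<in> D" for i
    by (induction i) (use assms opp_in nxt_in in auto)
  have period: "(?f ^^ (i + l)) d = (?f ^^ i) d" for i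
    by (simp add: funpow_add l(2))
  have "6 \<le> (\<Sum>i<l. corner_weight (side_at (opp ((?f ^^ i) d))) (side_at ((?f ^^ Suc i) d))
      + flow (side_at ((?f ^^ i) d)) (side_at (opp ((?f ^^ i) d))) (snd (lab ((?f ^^ i) d))))"
  proof (rule vertex_weight[OF l(1)])
    show "corner (side_at (opp ((?f ^^ i) d))) (lab ((?f ^^ i) d)) (side_at ((?f ^^ Suc i) d))
        (lab ((?f ^^ Suc i) d))" for i
      using corner_nxt[OF opp_in[OF D[of i]]] lab_opp[OF D[of i]] by simp
    show "unfolded3 (side_at (opp ((?f ^^ i) d))) (snd (lab ((?f ^^ i) d))) (side_at ((?f ^^ Suc i) d))
        (side_at (opp ((?f ^^ Suc i) d))) (side_at ((?f ^^ Suc (Suc i)) d))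
        (snd (lab ((?f ^^ Suc (Suc i)) d)))" for i
      using unfolded3_at[OF D[of i]] by simp
  qed (use period unfolded_at[OF D] in simp_all)
  then show ?thesis
    by (simp add: l(3) corner_value_def)
qed

lemma pos_orbit:
  assumes "d \<in> D" "a < len"
  obtains x where "x \<in> orbit nxt d" "pos x = a"
proof -
  define e :: int where "e = (if pos_or d then 1 else -1)"
  have step: "(nxt ^^ i) d \<in> D \<and> pos_or ((nxt ^^ i) d) = pos_or d \<and>
      int (pos ((nxt ^^ i) d)) = (int (pos d) + e * int i) mod int len" for i
  proof (induction i)
    case 0
    then show ?case using assms pos_len by simp
  next
    case (Suc i)
    let ?x = "(nxt ^^ i) d"
    have "int (pos (nxt ?x)) = (int (pos ?x) + e) mod int len"
    proof (cases "pos_or d")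
      case True
      then show ?thesis using Suc pos_nxt_or[of ?x] by (simp add: e_def zmod_int add.commute)
    next
      case False
      then have "pos (nxt ?x) = (pos ?x + len - 1) mod len"
        using Suc pos_nxt_eq[of ?x] by simp
      then have "int (pos (nxt ?x)) = (int (pos ?x) + int len - 1) mod int len"
        by (simp add: zmod_int of_nat_diff len_def)
      also have "\<dots> = (int (pos ?x) - 1 + int len) mod int len"
        by (simp add: algebra_simps)
      finally show ?thesis using False by (simp add: e_def)
    qed
    then show ?case
      using Suc nxt_in[of ?x] pos_or_nxt[of ?x] by (simp add: mod_simps algebra_simps)
  qed
  \<comment> \<open>Solves \<open>pos d + e * i = a\<close> modulo \<open>len\<close>, as
    \<open>e * e = 1\<close>.\<close>
  define i where "i = nat ((e * (int a - int (pos d))) mod int len)"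
  have i: "int i = (e * (int a - int (pos d))) mod int len"
    by (simp add: i_def len_def)
  have "(int (pos d) + e * int i) mod int len = (int (pos d) + e * (e * (int a - int (pos d)))) mod int len"
    unfolding i by (metis mod_add_right_eq mod_mult_right_eq)
  also have "e * (e * (int a - int (pos d))) = int a - int (pos d)"
    by (simp add: e_def)
  finally have "(int (pos d) + e * int i) mod int len = int a"
    using assms(2) by simp
  then have "pos ((nxt ^^ i) d) = a" using step[of i] by simp
  moreover have "(nxt ^^ i) d \<in> orbit nxt d"
    by (auto simp: orbit_altdef_permutation[OF permutation_nxt])
  ultimately show thesis using that by blast
qed

lemma face_turning:
  assumes "d \<in> D"
  shows "6 \<le> sum turning (orbit nxt d)"
proof -
  let ?X = "{x \<in> orbit nxt d. side_at x \<noteq> side_at (nxt x)}"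
  have fin: "finite (orbit nxt d)"
    by (rule finite_orbit[OF permutation_self_in_orbit[OF permutation_nxt]])
  have inv: "x \<in> D \<and> pos_or x = pos_or d" if "x \<in> orbit nxt d" for x
    using that by induction (use assms pos_or_nxt nxt_in in auto)
  \<comment> \<open>The positions where a syllable is left: its last letter when the relator is read
    forwards, its first when read backwards.\<close>
  define Y where "Y = (if pos_or d then {0, len_t, len_t + len_m, len_t + len_m + 1, len_t + 2 * len_m + 1, 2 * len_t + 2 * len_m + 1}
    else {0, 1, len_t + 1, len_t + len_m + 1, len_t + len_m + 2, len_t + 2 * len_m + 2})"
  have "Y \<subseteq> pos ` ?X"
  proof
    fix a assume a: "a \<in> Y"
    then have "a < len"
      using len_t_pos len_m_pos by (auto simp: Y_def len_def split: if_splits)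
    then obtain x where x: "x \<in> orbit nxt d" "pos x = a"
      using pos_orbit assms by blast
    have "role a \<noteq> role (pos (nxt x))"
    proof (cases "pos_or d")
      case True
      then have "pos (nxt x) = (a + 1) mod len"
        using pos_nxt_or[of x] inv[OF x(1)] x(2) by simp
      then show ?thesis
        using True a len_t_pos len_m_pos by (auto simp: Y_def role_def len_def)
    next
      case False
      then have "pos (nxt x) = (a + len - 1) mod len"
        using pos_nxt_eq[of x] inv[OF x(1)] x(2) by simp
      moreover have "(a + len - 1) mod len = (if a = 0 then len - 1 else a - 1)"
        using \<open>a < len\<close> by (auto simp: mod_if len_def)
      ultimately show ?thesis
        using False a len_t_pos len_m_pos by (auto simp: Y_def role_def len_def)
    qed
    then show "a \<in> pos ` ?X"
      using x by (auto simp: side_at_def)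
  qed
  then have "card Y \<le> card (pos ` ?X)"
    using fin by (intro card_mono) auto
  also have "\<dots> \<le> card ?X"
    using fin by (intro card_image_le) auto
  finally have "card Y \<le> card ?X" .
  moreover have "card Y = 6"
    using len_t_pos len_m_pos by (auto simp: Y_def card_insert_if)
  moreover have "sum turning (orbit nxt d) = int (card ?X)"
    using fin by (simp add: turning_def sum.If_cases Int_def)
  ultimately show ?thesis by simp
qed

text \<open>The flow cancels over the two orientations of each edge, and weight and turning add up
  to \<open>3\<close> at every corner.\<close>

lemma total_value: "sum corner_value D + sum turning D = 3 * int (card D)"
proof -
  let ?flow = "\<lambda>d. flow (side_at d) (side_at (opp d)) (snd (lab d))"
  have "sum ?flow D = (\<Sum>d\<in>D. ?flow (opp d))"
    using sum.permute[OF opp_permutes, of ?flow] by simp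
  also have "\<dots> = (\<Sum>d\<in>D. - ?flow d)"
  proof (rule sum.cong)
    fix d assume "d \<in> D"
    then show "?flow (opp d) = - ?flow d"
      using flow_swap[of "side_at (opp d)" "side_at d" "snd (lab d)"]
      by (simp add: opp_opp lab_opp inv_letter_def)
  qed simp
  finally have flow: "sum ?flow D = 0"
    by (simp add: sum_negf)
  have "(\<Sum>d\<in>D. corner_weight (side_at (opp d)) (side_at (nxt (opp d))))
      = (\<Sum>d\<in>D. corner_weight (side_at d) (side_at (nxt d)))"
    using sum.permute[OF opp_permutes, of "\<lambda>d. corner_weight (side_at d) (side_at (nxt d))"]
    by simp
  also have "\<dots> = (\<Sum>d\<in>D. 3 - turning d)"
    by (intro sum.cong) (auto simp: corner_weight_def turning_def)
  finally show ?thesis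
    by (simp add: corner_value_def sum.distrib flow sum_subtractf)
qed

lemma contradiction: False
  using curvature_contradiction[OF vertex_value face_turning] total_value by simp

end

theorem theorem3p1:
  fixes n :: nat and j k t m :: int and w :: "int word"
  assumes "n \<ge> 1"
    and "w = gen_power (gen n j) t @ gen_power (gen n k) m"
    and "t \<noteq> 0" and "m \<noteq> 0"
    and "\<not> [j = k] (mod int n)"
    and "\<not> [j = 1] (mod int n)"
    and "\<not> [k = 2] (mod int n)"
    and "\<not> [2 * j - 1 = k] (mod int n)"
    and "\<not> [j = k - 1] (mod int n)"
    and "\<not> [j = 2 * k - 2] (mod int n)"
    and "\<not> [j + k = 3] (mod int n)"
  shows "diagrammatically_reducible (cyclic_presentation n w)"
proof -
  \<comment> \<open>The seven incongruences are exactly the seven non-divisibility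
    assumptions.\<close>
  have link: "link_parameters (int n) (j - 1) (k - 2) (k - j)"
  proof
    show "\<not> int n dvd k - j"
      using assms(5) by (simp add: cong_iff_dvd_diff dvd_diff_commute)
    show "\<not> int n dvd k - 2 + (k - j)"
    proof -
      have "k - 2 + (k - j) = - (j - (2 * k - 2))" by simp
      then show ?thesis using assms(10) unfolding cong_iff_dvd_diff by (metis dvd_minus_iff)
    qed
  qed (use assms in \<open>simp_all add: cong_iff_dvd_diff algebra_simps\<close>)
  have False
    if "spherical_diagram (cyclic_presentation n w) D opp nxt lab cell pos pos_or"
      "spherical_diagram.reduced D opp nxt cell pos pos_or"
    for D :: "nat set" and opp nxt lab cell pos pos_or
  proof -
    interpret spherical_diagram "cyclic_presentation n w" D opp nxt lab cell pos pos_or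
      by (fact that(1))
    interpret link_parameters "int n" "j - 1" "k - 2" "k - j" "\<lambda>p. if p then 0 < t else \<not> 0 < m"
      by (fact link)
    interpret cyclic_diagram n w D opp nxt lab cell pos pos_or j k t m
      by unfold_locales (use assms that(2) in auto)
    show False by (rule contradiction)
  qed
  moreover have "relator (cyclic_presentation n w) i \<noteq> []" for i
    by (simp add: cyclic_presentation_def Let_def)
  ultimately show ?thesis
    unfolding diagrammatically_reducible_def by blast
qed

end
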